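(* Let $p$ be a prime, let $1\le s\le p-1$, and let $n$ be a positive integer. Fix $m$ with $0\le m\le s-1$, and let $R\subseteq\{0,1,\dots,p-1\}$ be a set of size $m$ disjoint from $\{0,1,\dots,s-m-1\}$. Set $$L:=\{0,1,\dots,s-m-1\}\cup R\subseteq\mathbb{F}_p,$$ and let $K\subseteq\mathbb{F}_p\setminus L$. Let $\mathcal{F}$ be a family of subsets of $[n]$ satisfying (i) $|F| \bmod p\in K$ for every $F\in\mathcal{F}$; (ii) $|E\cap F|\bmod p\in L$ for all distinct $E,F\in\mathcal{F}$. Then $$|\mathcal{F}|\le\sum_{i=0}^{m}\binom{n}{s-i}.$$ More precisely, $$|\mathcal{F}|+\sum_{j\in\operatorname{bsupp}(L)}|\mathcal{N}_j(\mathcal{F})|\le\sum_{i=0}^{m}\binom{n}{s-i}.$$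
   Context: Here $[n]=\{1,\dots,n\}$, $\binom{[n]}{t}$ is the set of all $t$-element subsets of $[n]$ (empty if $t>n$), and integers in $\{0,\dots,p-1\}$ are identified with their residues in $\mathbb{F}_p$. For an integer $t\ge 0$, the $t$-shadow of $\mathcal{F}$ is $\partial_t\mathcal{F}=\{T\in\binom{[n]}{t}:\exists F\in\mathcal{F}\text{ with }T\subseteq F\}$, and the $t$-non-shadow is $\mathcal{N}_t(\mathcal{F})=\binom{[n]}{t}\setminus\partial_t\mathcal{F}$ (both are empty when $t>n$). For $L\subseteq\mathbb{F}_p$ with $|L|=s<p$, put $P_L(t)=\prod_{\ell\in L}(t-\ell)\in\mathbb{F}_p[t]$. For $0\le j\le s$, $\binom{t}{j}=\frac{1}{j!}t(t-1)\cdots(t-j+1)\in\mathbb{F}_p[t]$ denotes the binomial polynomial (well defined since $j\le s<p$); these polynomials form a basis of the space of polynomials of degree at most $s$ over $\mathbb{F}_p$. Write uniquely $P_L(t)=\sum_{j=0}^{s}c_j(L)\binom{t}{j}$ with $c_j(L)\in\mathbb{F}_p$, and set $\operatorname{bsupp}(L)=\{j\in\{0,1,\dots,s\}:c_j(L)\ne 0\}$. *)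

theory Defs
  imports "HOL-Computational_Algebra.Polynomial" "Berlekamp_Zassenhaus.Finite_Field"
begin

definition shadow :: "nat \<Rightarrow> nat \<Rightarrow> nat set set \<Rightarrow> nat set set" where
  "shadow n t \<F> = {T. T \<subseteq> {1..n} \<and> card T = t \<and> (\<exists>F\<in>\<F>. T \<subseteq> F)}"

definition nonshadow :: "nat \<Rightarrow> nat \<Rightarrow> nat set set \<Rightarrow> nat set set" where
  "nonshadow n t \<F> = {T. T \<subseteq> {1..n} \<and> card T = t} - shadow n t \<F>"

definition root_poly :: "'a::field set \<Rightarrow> 'a poly" where
  "root_poly L = (\<Prod>l\<in>L. [:- l, 1:])"

text \<open>The binomial polynomial \<open>t (t - 1) \<dots> (t - j + 1) / j!\<close>; it is meaningful only if
  \<open>j!\<close> is invertible, i.e. over the field with \<open>p\<close> elements only for \<open>j < p\<close>.\<close>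

definition binomial_poly :: "nat \<Rightarrow> 'a::field poly" where
  "binomial_poly j = smult (inverse (of_nat (fact j))) (\<Prod>i<j. [:- of_nat i, 1:])"

text \<open>The coefficients of \<^term>\<open>root_poly L\<close> in the basis of binomial polynomials of degree at
  most \<^term>\<open>card L\<close>. The lemmas below show that the description is proper when
  \<open>card L < p\<close>; outside \<open>{0..card L}\<close> the coefficients are set to \<open>0\<close>.\<close>

definition binomial_coeffs :: "'a::field set \<Rightarrow> nat \<Rightarrow> 'a" where
  "binomial_coeffs L = (THE c. (\<forall>j>card L. c j = 0) \<and>
     root_poly L = (\<Sum>j\<le>card L. smult (c j) (binomial_poly j)))"

definition bsupp :: "'a::field set \<Rightarrow> nat set" where
  "bsupp L = {j \<in> {0..card L}. binomial_coeffs L j \<noteq> 0}"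

lemma ex1_graded_expansion:
  fixes b :: "nat \<Rightarrow> 'a::field poly"
  assumes "\<And>j. j \<le> s \<Longrightarrow> degree (b j) = j \<and> b j \<noteq> 0" and "degree q \<le> s"
  shows "\<exists>!c. (\<forall>j>s. c j = 0) \<and> q = (\<Sum>j\<le>s. smult (c j) (b j))"
  using assms
proof (induction s arbitrary: q)
  case 0
  then obtain u v where u: "b 0 = [:u:]" and v: "q = [:v:]"
    by (metis degree_eq_zeroE le_zero_eq)
  have "u \<noteq> 0" using 0 u by force
  show ?case
  proof (rule ex1I)
    show "(\<forall>j>0::nat. (\<lambda>j::nat. if j = 0 then v / u else 0) j = 0) \<and>
        q = (\<Sum>j\<le>0. smult ((\<lambda>j. if j = 0 then v / u else 0) j) (b j))"
      using \<open>u \<noteq> 0\<close> by (simp add: u v)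
    fix c assume "(\<forall>j>0. c j = 0) \<and> q = (\<Sum>j\<le>0. smult (c j) (b j))"
    then show "c = (\<lambda>j. if j = 0 then v / u else 0)"
      using \<open>u \<noteq> 0\<close> by (auto simp: u v fun_eq_iff)
  qed
next
  case (Suc s)
  have dS: "degree (b (Suc s)) = Suc s" and nz: "b (Suc s) \<noteq> 0"
    using Suc.prems(1) by auto
  have lc: "coeff (b (Suc s)) (Suc s) \<noteq> 0"
    using leading_coeff_neq_0[OF nz] dS by simp
  have low: "coeff (\<Sum>j\<le>s. smult (c j) (b j)) (Suc s) = 0" for c
    by (auto simp: coeff_sum Suc.prems(1) intro!: sum.neutral coeff_eq_0)
  define a where "a = coeff q (Suc s) / coeff (b (Suc s)) (Suc s)"
  define r where "r = q - smult a (b (Suc s))"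
  have "degree r \<le> s"
  proof (rule degree_le, intro allI impI)
    fix i assume "i > s"
    then consider "i = Suc s" | "i > Suc s" by linarith
    then show "coeff r i = 0"
      using lc Suc.prems(2) dS by cases (auto simp: r_def a_def coeff_eq_0)
  qed
  moreover have "\<And>j. j \<le> s \<Longrightarrow> degree (b j) = j \<and> b j \<noteq> 0"
    using Suc.prems(1) by simp
  ultimately have ex1: "\<exists>!c. (\<forall>j>s. c j = 0) \<and> r = (\<Sum>j\<le>s. smult (c j) (b j))"
    using Suc.IH[of r] by simp
  then obtain c where c: "\<forall>j>s. c j = 0" "r = (\<Sum>j\<le>s. smult (c j) (b j))"
    and uniq: "\<And>d. (\<forall>j>s. d j = 0) \<and> r = (\<Sum>j\<le>s. smult (d j) (b j)) \<Longrightarrow> d = c"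
    by (elim ex1E) blast
  show ?case
  proof (rule ex1I)
    have "(\<Sum>j\<le>s. smult ((c(Suc s := a)) j) (b j)) = r"
      unfolding c(2) by (rule sum.cong) auto
    then show "(\<forall>j>Suc s. (c(Suc s := a)) j = 0) \<and>
        q = (\<Sum>j\<le>Suc s. smult ((c(Suc s := a)) j) (b j))"
      using c(1) by (simp add: r_def)
    fix d assume d: "(\<forall>j>Suc s. d j = 0) \<and> q = (\<Sum>j\<le>Suc s. smult (d j) (b j))"
    have "coeff q (Suc s) = d (Suc s) * coeff (b (Suc s)) (Suc s)"
      using d low[of d] by simp
    then have da: "d (Suc s) = a" using lc by (simp add: a_def)
    have "(\<Sum>j\<le>s. smult ((d(Suc s := 0)) j) (b j)) = (\<Sum>j\<le>s. smult (d j) (b j))"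
      by (rule sum.cong) auto
    also have "\<dots> = r" using d da by (simp add: r_def)
    finally have "(\<forall>j>s. (d(Suc s := 0)) j = 0) \<and> r = (\<Sum>j\<le>s. smult ((d(Suc s := 0)) j) (b j))"
      using d by auto
    from uniq[OF this] da show "d = c(Suc s := a)" by auto
  qed
qed

lemma degree_binomial_poly:
  assumes "j < CARD('p::prime_card)"
  shows "degree (binomial_poly j :: 'p mod_ring poly) = j \<and> (binomial_poly j :: 'p mod_ring poly) \<noteq> 0"
proof -
  have pr: "prime CARD('p)" by (rule prime_card)
  have "\<not> CARD('p) dvd fact j"
    using assms prime_dvd_fact_iff[OF pr] by simp
  then have f: "(of_nat (fact j) :: 'p mod_ring) \<noteq> 0"
    using of_nat_0_mod_ring_dvd by blast
  have "degree (\<Prod>i<j. [:- of_nat i, 1 :: 'p mod_ring:]) = j"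
    by (subst degree_prod_eq_sum_degree) auto
  moreover have "(\<Prod>i<j. [:- of_nat i, 1 :: 'p mod_ring:]) \<noteq> 0"
    by (subst prod_zero_iff) auto
  ultimately show ?thesis using f by (simp add: binomial_poly_def)
qed

lemma binomial_coeffs:
  fixes L :: "'p::prime_card mod_ring set"
  assumes "card L < CARD('p)"
  shows "\<exists>!c. (\<forall>j>card L. c j = 0) \<and>
      root_poly L = (\<Sum>j\<le>card L. smult (c j) (binomial_poly j))" (is "\<exists>!c. ?P c")
    and "\<And>j. j > card L \<Longrightarrow> binomial_coeffs L j = 0"
    and "root_poly L = (\<Sum>j\<le>card L. smult (binomial_coeffs L j) (binomial_poly j))"
proof -
  have "degree (root_poly L) \<le> card L"
    unfolding root_poly_def by (subst degree_prod_eq_sum_degree) auto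
  with assms show *: "\<exists>!c. ?P c"
    by (intro ex1_graded_expansion degree_binomial_poly) auto
  have "?P (binomial_coeffs L)"
    unfolding binomial_coeffs_def by (rule theI'[OF *])
  then show "\<And>j. j > card L \<Longrightarrow> binomial_coeffs L j = 0"
    and "root_poly L = (\<Sum>j\<le>card L. smult (binomial_coeffs L j) (binomial_poly j))"
    by blast+
qed

end

theory Submission
  imports Defs "HOL-Library.Function_Algebras"
begin

text \<open>Expanding \<open>P\<^sub>L(|E \<inter> F|)\<close> in the binomial basis counts, with weight \<open>c\<^sub>j(L)\<close>, the common
  \<open>j\<close>-subsets of \<open>E\<close> and \<open>F\<close>, all of which lie in the shadow. This value is nonzero exactly when
  \<open>E = F\<close>, so the incidence vectors of the members of \<open>\<F>\<close> on the shadows of the levels in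
  \<open>bsupp L\<close> are orthogonal for a weighted bilinear form, and there are at most as many of them as
  coordinates. Finally \<open>P\<^sub>L\<close> vanishes at \<open>0, \<dots>, s - m - 1\<close>, which forces \<open>c\<^sub>j(L) = 0\<close> for
  \<open>j < s - m\<close>.\<close>

text \<open>Pairing a linear relation among the \<open>v j\<close> with \<open>u i\<close> isolates
  the coefficient of \<open>v i\<close>, so the \<open>v j\<close>, restricted to \<open>X\<close>,
  are independent in a space of dimension \<open>card X\<close>.\<close>

lemma biorthogonal_card_le:
  fixes u v :: "'i \<Rightarrow> 't \<Rightarrow> 'a::field"
  assumes "finite I" and "finite X"
    and diag: "\<And>i. i \<in> I \<Longrightarrow> (\<Sum>t\<in>X. u i t * v i t) \<noteq> 0"
    and off: "\<And>i j. i \<in> I \<Longrightarrow> j \<in> I \<Longrightarrow> i \<noteq> j \<Longrightarrow> (\<Sum>t\<in>X. u i t * v j t) = 0"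
  shows "card I \<le> card X"
proof -
  interpret V: vector_space "\<lambda>(c::'a) (f::'t \<Rightarrow> 'a) x. c * f x"
    by unfold_locales (auto simp: fun_eq_iff algebra_simps)
  have sum_app: "sum f A x = (\<Sum>a\<in>A. f a x)" for f :: "'b \<Rightarrow> 't \<Rightarrow> 'a" and A x
    by (induction A rule: infinite_finite_induct) auto
  \<comment> \<open>Cutting \<open>v\<close> off outside \<open>X\<close> puts it in the span of the
    \<open>card X\<close> indicator functions; sums over \<open>X\<close> do not see the
    change.\<close>
  define w where "w i t = (if t \<in> X then v i t else 0)" for i t
  define e where "e t = (\<lambda>x. if x = t then 1 else 0 :: 'a)" for t :: 't
  have form: "(\<Sum>t\<in>X. u i t * w j t) = (\<Sum>t\<in>X. u i t * v j t)" for i j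
    by (rule sum.cong) (auto simp: w_def)
  have inj: "inj_on w I"
  proof (rule inj_onI, rule ccontr)
    fix i j assume "i \<in> I" "j \<in> I" "w i = w j" "i \<noteq> j"
    then show False using diag[of i] off[of i j] form[of i i] form[of i j] by simp
  qed
  have "w ` I \<subseteq> V.span (e ` X)"
  proof (rule image_subsetI)
    fix i
    have "w i = (\<Sum>t\<in>X. (\<lambda>x. w i t * e t x))"
    proof
      fix x
      have "(\<Sum>t\<in>X. w i t * e t x) = (\<Sum>t\<in>X. if t = x then w i t else 0)"
        by (rule sum.cong) (auto simp: e_def)
      also have "\<dots> = w i x"
        using \<open>finite X\<close> by (simp add: w_def)
      finally show "w i x = (\<Sum>t\<in>X. (\<lambda>x. w i t * e t x)) x"
        by (simp add: sum_app)
    qed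
    also have "\<dots> \<in> V.span (e ` X)"
      by (intro V.span_sum V.span_scale V.span_base) auto
    finally show "w i \<in> V.span (e ` X)" .
  qed
  moreover have "V.independent (w ` I)"
  proof (rule V.independent_if_scalars_zero)
    show "finite (w ` I)" using \<open>finite I\<close> by simp
    fix a x assume 0: "(\<Sum>x\<in>w ` I. (\<lambda>t. a x * x t)) = 0" and "x \<in> w ` I"
    then obtain i where i: "i \<in> I" "x = w i" by auto
    have "(\<Sum>j\<in>I. a (w j) * w j t) = 0" for t
      using fun_cong[OF 0, of t] by (simp add: sum_app sum.reindex[OF inj])
    then have "0 = (\<Sum>t\<in>X. u i t * (\<Sum>j\<in>I. a (w j) * w j t))" by simp
    also have "\<dots> = (\<Sum>j\<in>I. a (w j) * (\<Sum>t\<in>X. u i t * w j t))"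
      by (simp add: sum_distrib_left mult_ac) (rule sum.swap)
    also have "\<dots> = (\<Sum>j\<in>I. if j = i then a (w i) * (\<Sum>t\<in>X. u i t * v i t) else 0)"
      using off i by (intro sum.cong) (auto simp: form)
    also have "\<dots> = a (w i) * (\<Sum>t\<in>X. u i t * v i t)"
      using \<open>finite I\<close> i by simp
    finally show "a x = 0" using diag i by simp
  qed
  ultimately have "card (w ` I) \<le> card (e ` X)"
    using V.independent_span_bound \<open>finite X\<close> by blast
  then show ?thesis
    using card_image[OF inj] card_image_le[OF \<open>finite X\<close>, of e] by simp
qed

lemma prod_diff_of_nat_eq_fact_binomial:
  "(\<Prod>i<j. of_nat a - of_nat i) = (of_nat (fact j * (a choose j)) :: 'a::comm_ring_1)"
proof (induction j)
  case (Suc j)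
  \<comment> \<open>Truncated subtraction is harmless: for \<open>a < j\<close> the factor
    \<open>a choose j\<close> vanishes.\<close>
  have "(of_nat a - of_nat j) * of_nat (a choose j) = (of_nat ((a - j) * (a choose j)) :: 'a)"
    by (cases "j \<le> a") (auto simp: of_nat_diff binomial_eq_0)
  also have "(a - j) * (a choose j) = Suc j * (a choose Suc j)"
    by (simp only: binomial_absorb_comp binomial_absorption)
  finally show ?case
    by (simp add: Suc.IH algebra_simps)
qed simp

text \<open>For \<open>j < p\<close> the factorial is invertible modulo \<open>p\<close>, so it can
  be cancelled; \<open>a\<close> itself may exceed \<open>p\<close>.\<close>

lemma poly_binomial_poly_of_nat:
  assumes "j < CARD('p::prime_card)"
  shows "poly (binomial_poly j) (of_nat a :: 'p mod_ring) = of_nat (a choose j)"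
proof -
  have "(of_nat (fact j) :: 'p mod_ring) \<noteq> 0"
    using assms prime_dvd_fact_iff[OF prime_card[where 'a='p]] of_nat_0_mod_ring_dvd[where 'a='p]
    by (metis not_le)
  moreover have "poly (\<Prod>i<j. [:- of_nat i, 1:]) (of_nat a :: 'p mod_ring) =
      of_nat (fact j * (a choose j))"
    by (simp add: poly_prod prod_diff_of_nat_eq_fact_binomial)
  ultimately show ?thesis
    by (simp add: binomial_poly_def del: of_nat_fact)
qed

lemma poly_root_poly_eq_0_iff:
  "finite L \<Longrightarrow> poly (root_poly L) x = 0 \<longleftrightarrow> x \<in> L"
  by (auto simp: root_poly_def poly_prod)

lemma finite_bsupp: "finite (bsupp L)"
  by (simp add: bsupp_def)

lemma poly_root_poly_of_nat:
  fixes L :: "'p::prime_card mod_ring set"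
  assumes "card L < CARD('p)"
  shows "poly (root_poly L) (of_nat a) = (\<Sum>j\<in>bsupp L. binomial_coeffs L j * of_nat (a choose j))"
proof -
  have "poly (root_poly L) (of_nat a) =
      (\<Sum>j\<le>card L. binomial_coeffs L j * of_nat (a choose j))"
    using assms by (subst binomial_coeffs(3)[OF assms])
      (simp add: poly_sum poly_binomial_poly_of_nat)
  also have "\<dots> = (\<Sum>j\<in>bsupp L. binomial_coeffs L j * of_nat (a choose j))"
    by (rule sum.mono_neutral_right) (auto simp: bsupp_def)
  finally show ?thesis .
qed

text \<open>The system is triangular: at a root \<open>i < k\<close> the binomials with
  \<open>l > i\<close> vanish, and those with \<open>l < i\<close> have coefficient zero by
  induction, which leaves exactly the coefficient at \<open>i\<close>.\<close>

lemma bsupp_ge: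
  fixes L :: "'p::prime_card mod_ring set"
  assumes "card L < CARD('p)" and "of_nat ` {..<k} \<subseteq> L" and "j \<in> bsupp L"
  shows "k \<le> j"
proof -
  have "binomial_coeffs L i = 0" if "i < k" for i
    using that
  proof (induction i rule: less_induct)
    case (less i)
    have "binomial_coeffs L l * of_nat (i choose l) = (if l = i then binomial_coeffs L i else 0)"
      for l
      using less.IH[of l] less.prems by (cases l i rule: linorder_cases) (auto simp: binomial_eq_0)
    then have "(\<Sum>l\<in>bsupp L. binomial_coeffs L l * of_nat (i choose l)) =
        (if i \<in> bsupp L then binomial_coeffs L i else 0)"
      by (simp add: finite_bsupp)
    moreover have "poly (root_poly L) (of_nat i) = 0"
      using assms(2) less.prems by (subst poly_root_poly_eq_0_iff) auto
    ultimately show ?case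
      using poly_root_poly_of_nat[OF assms(1), of i] binomial_coeffs(2)[OF assms(1), of i]
      by (cases "i \<in> bsupp L") (auto simp: bsupp_def not_le)
  qed
  with assms(3) show ?thesis
    by (auto simp: bsupp_def simp flip: not_less)
qed

lemma finite_shadow: "finite (shadow n t \<F>)"
  by (rule finite_subset[of _ "Pow {1..n}"]) (auto simp: shadow_def)

lemma card_shadow_plus_card_nonshadow:
  "card (shadow n t \<F>) + card (nonshadow n t \<F>) = n choose t"
proof -
  have "card {T. T \<subseteq> {1..n} \<and> card T = t} = n choose t"
    using n_subsets[of "{1..n}" t] by simp
  moreover have "shadow n t \<F> \<subseteq> {T. T \<subseteq> {1..n} \<and> card T = t}"
    by (auto simp: shadow_def)
  moreover have "finite {T. T \<subseteq> {1..n} \<and> card T = t}"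
    by (rule finite_subset[of _ "Pow {1..n}"]) auto
  ultimately show ?thesis
    using card_mono[of "{T. T \<subseteq> {1..n} \<and> card T = t}" "shadow n t \<F>"]
    by (simp add: nonshadow_def card_Diff_subset finite_shadow)
qed

text \<open>Taking only shadow sets as coordinates, rather than all \<open>j\<close>-subsets, is
  what later yields the non-shadow term.\<close>

lemma card_le_sum_card_shadow:
  fixes L :: "'p::prime_card mod_ring set"
  assumes "card L < CARD('p)" and "\<F> \<subseteq> Pow {1..n}"
    and diag: "\<And>F. F \<in> \<F> \<Longrightarrow> of_nat (card F) \<notin> L"
    and off: "\<And>E F. E \<in> \<F> \<Longrightarrow> F \<in> \<F> \<Longrightarrow> E \<noteq> F \<Longrightarrow> of_nat (card (E \<inter> F)) \<in> L"
  shows "card \<F> \<le> (\<Sum>j\<in>bsupp L. card (shadow n j \<F>))"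
proof -
  define X where "X = (\<Union>j\<in>bsupp L. shadow n j \<F>)"
  define v :: "nat set \<Rightarrow> nat set \<Rightarrow> 'p mod_ring" where "v F T = of_bool (T \<subseteq> F)" for F T
  \<comment> \<open>The weight goes into one side only, which turns the weighted form into a plain
    pairing of \<open>u\<close> with \<open>v\<close>.\<close>
  define u where "u F T = binomial_coeffs L (card T) * v F T" for F T
  have "finite X"
    by (simp add: X_def finite_bsupp finite_shadow)
  have disj: "shadow n i \<F> \<inter> shadow n j \<F> = {}" if "i \<noteq> j" for i j
    using that by (auto simp: shadow_def)
  have form: "(\<Sum>T\<in>X. u E T * v F T) = poly (root_poly L) (of_nat (card (E \<inter> F)))"
    if "E \<in> \<F>" for E F
  proof -
    have "(\<Sum>T\<in>X. u E T * v F T) = (\<Sum>j\<in>bsupp L. \<Sum>T\<in>shadow n j \<F>. u E T * v F T)"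
      unfolding X_def
      by (rule sum.UNION_disjoint) (auto simp: finite_bsupp finite_shadow disj)
    also have "\<dots> = (\<Sum>j\<in>bsupp L. binomial_coeffs L j * of_nat (card (E \<inter> F) choose j))"
    proof (rule sum.cong[OF refl])
      fix j
      have E: "finite E" "E \<subseteq> {1..n}"
        using that assms(2) finite_subset[of E "{1..n}"] by auto
      have "(\<Sum>T\<in>shadow n j \<F>. u E T * v F T) =
          (\<Sum>T\<in>shadow n j \<F>. binomial_coeffs L j * of_bool (T \<subseteq> E \<inter> F))"
        by (rule sum.cong) (auto simp: u_def v_def shadow_def)
      also have "\<dots> = binomial_coeffs L j * of_nat (card (shadow n j \<F> \<inter> {T. T \<subseteq> E \<inter> F}))"
        by (simp add: finite_shadow flip: sum_distrib_left)
      \<comment> \<open>Every subset of \<open>E \<inter> F\<close> lies in the member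
        \<open>E\<close>, so restricting to the shadow loses nothing in the count.\<close>
      also have "shadow n j \<F> \<inter> {T. T \<subseteq> E \<inter> F} = {T. T \<subseteq> E \<inter> F \<and> card T = j}"
        using E that by (auto simp: shadow_def)
      also have "card \<dots> = card (E \<inter> F) choose j"
        using E n_subsets[of "E \<inter> F" j] by simp
      finally show "(\<Sum>T\<in>shadow n j \<F>. u E T * v F T) =
          binomial_coeffs L j * of_nat (card (E \<inter> F) choose j)" .
    qed
    finally show ?thesis
      by (simp add: poly_root_poly_of_nat[OF assms(1)])
  qed
  have "card \<F> \<le> card X"
  proof (rule biorthogonal_card_le[where u = u and v = v])
    show "finite \<F>" using assms(2) by (rule finite_subset) simp
    show "finite X" by fact
  qed (simp_all add: form poly_root_poly_eq_0_iff diag off)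
  also have "\<dots> \<le> (\<Sum>j\<in>bsupp L. card (shadow n j \<F>))"
    unfolding X_def by (rule card_UN_le[OF finite_bsupp])
  finally show ?thesis .
qed

theorem corollary8:
  fixes p s n m :: nat
    and R :: "nat set"
    and L K :: "'p::prime_card mod_ring set"
    and \<F> :: "nat set set"
  assumes "p = CARD('p)"
    and "1 \<le> s" and "s \<le> p - 1"
    and "0 < n"
    and "m \<le> s - 1"
    and "R \<subseteq> {0..p - 1}" and "card R = m" and "R \<inter> {0..s - m - 1} = {}"
    and "L = of_nat ` ({0..s - m - 1} \<union> R)"
    and "K \<subseteq> UNIV - L"
    and "\<F> \<subseteq> Pow {1..n}"
    and "\<And>F. F \<in> \<F> \<Longrightarrow> of_nat (card F) \<in> K"
    and "\<And>E F. E \<in> \<F> \<Longrightarrow> F \<in> \<F> \<Longrightarrow> E \<noteq> F \<Longrightarrow> of_nat (card (E \<inter> F)) \<in> L"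
  shows "card \<F> \<le> (\<Sum>i=0..m. n choose (s - i)) \<and>
    card \<F> + (\<Sum>j\<in>bsupp L. card (nonshadow n j \<F>)) \<le> (\<Sum>i=0..m. n choose (s - i))"
proof -
  \<comment> \<open>Positivity of \<open>p\<close> is what turns \<open>s \<le> p - 1\<close> into
    \<open>s < p\<close> under truncated subtraction.\<close>
  have "2 \<le> p"
    using prime_ge_2_nat[OF prime_card[where 'a='p]] assms(1) by simp
  then have "s < CARD('p)" and "{0..s - m - 1} \<union> R \<subseteq> {0..<CARD('p)}"
    using assms(1,3,6) by auto
  \<comment> \<open>Distinct representatives below \<open>p\<close> stay distinct as residues, so
    \<open>L\<close> has \<open>(s - m) + m = s\<close> elements.\<close>
  moreover have "inj_on (of_nat :: nat \<Rightarrow> 'p mod_ring) {0..<CARD('p)}"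
    by (rule inj_onI) (simp add: of_nat_eq_iff_cong_CHAR cong_def)
  moreover have "finite R"
    using assms(6) by (rule finite_subset) simp
  ultimately have card_L: "card L = s"
    using assms(2,5,7,8)
    by (simp add: assms(9) card_image inj_on_subset card_Un_disjoint Int_commute)
  then have lt: "card L < CARD('p)"
    using \<open>s < CARD('p)\<close> by simp
  have "bsupp L \<subseteq> {s - m..s}"
  proof
    fix j assume "j \<in> bsupp L"
    moreover have "of_nat ` {..<s - m} \<subseteq> L"
      by (auto simp: assms(9))
    ultimately show "j \<in> {s - m..s}"
      using bsupp_ge[OF lt] by (auto simp: bsupp_def card_L)
  qed
  have "card \<F> \<le> (\<Sum>j\<in>bsupp L. card (shadow n j \<F>))"
    by (rule card_le_sum_card_shadow[OF lt assms(11)]) (use assms(10,12,13) in blast)+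
  \<comment> \<open>Adding the non-shadows completes each shadow to a full level of
    \<open>n choose j\<close> sets.\<close>
  then have "card \<F> + (\<Sum>j\<in>bsupp L. card (nonshadow n j \<F>)) \<le>
      (\<Sum>j\<in>bsupp L. card (shadow n j \<F>) + card (nonshadow n j \<F>))"
    by (simp add: sum.distrib)
  also have "\<dots> = (\<Sum>j\<in>bsupp L. n choose j)"
    by (simp add: card_shadow_plus_card_nonshadow)
  also have "\<dots> \<le> (\<Sum>j=s - m..s. n choose j)"
    using \<open>bsupp L \<subseteq> {s - m..s}\<close> by (intro sum_mono2) auto
  also have "\<dots> = (\<Sum>i=0..m. n choose (s - i))"
    by (rule sum.reindex_bij_witness[of _ "\<lambda>i. s - i" "\<lambda>j. s - j"]) (use assms(2,5) in auto)
  \<comment> \<open>The first bound follows by dropping the nonnegative non-shadow sum.\<close>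
  finally show ?thesis by simp
qed

end
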